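(* Let $R \subseteq \mathcal{O}(7)$ be a 1-dimensional space of quadratic relations, and let $\mathcal{I} = (R)$ be the operad ideal it generates. Then the rank of the cubic consequences of $R$ in arity 10 (that is, $\dim \mathcal{I}(10)$) is either 10 or 11. None of the corresponding quotient operads $\mathcal{O}/\mathcal{I}$ are nilpotent of index 3. For the subspaces $R$ spanned by each of the following 8 relations $\rho$, the rank is 10: (1a) $\rho = \phi \circ_1 \phi$; (1b) $\rho = \phi \circ_1 \phi - \phi \circ_4 \phi$; (1c) $\rho = \phi \circ_1 \phi - \phi \circ_2 \phi + \phi \circ_3 \phi - \phi \circ_4 \phi$; (1d) $\rho = \phi \circ_1 \phi + \alpha\, \phi \circ_2 \phi + \alpha^2\, \phi \circ_3 \phi - \phi \circ_4 \phi$, where $\alpha \in \mathbb{F}$ satisfies $\alpha^2 - \alpha + 1 = 0$ (two choices of $\alpha$); (2) $\rho = \phi \circ_2 \phi$; (3) $\rho = \phi \circ_3 \phi$; (4) $\rho = \phi \circ_4 \phi$. For all other 1-dimensional subspaces $R$, the rank is 11.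
   Context: $\mathbb{F}$ is an algebraically closed field of characteristic 0. $\mathcal{O}$ is the free nonsymmetric operad over $\mathbb{F}$ generated by one quaternary operation $\phi$ (of homological degree 0): $\mathcal{O}(k)$ is the vector space with basis the complete rooted planar 4-ary trees with $k$ leaves (each internal node, labelled $\phi$, has exactly 4 children), and for trees $\alpha,\beta$ of arities $k,\ell$ and $1 \le i \le k$, $\alpha \circ_i \beta$ is the tree of arity $k+\ell-1$ obtained by substituting the root of $\beta$ for the $i$-th leaf of $\alpha$ (leaves counted from left to right), extended bilinearly. $\mathcal{O}(7)$ has basis $\phi\circ_i\phi$ ($1 \le i \le 4$). $\mathcal{O}(10)$ has dimension 22, with basis $\phi \circ_i (\phi \circ_j \phi)$ ($1 \le i,j \le 4$) and $(\phi \circ_j \phi) \circ_i \phi$ ($1 \le i < j \le 4$). The operad ideal $\mathcal{I} = (R)$ generated by a subspace $R \subseteq \mathcal{O}(7)$ is the smallest subspace of $\mathcal{O}$ containing $R$ and closed under left and right compositions by arbitrary elements of $\mathcal{O}$; $\mathcal{I}(10) = \mathcal{I} \cap \mathcal{O}(10)$ is spanned by the cubic consequences $\rho \circ_i \phi$ ($1 \le i \le 7$) and $\phi \circ_j \rho$ ($1 \le j \le 4$) of the elements $\rho$ of a basis of $R$. The quotient operad $\mathcal{Q} = \mathcal{O}/\mathcal{I}$ is nilpotent of index 3 if every tree monomial involving three occurrences of $\phi$ is zero in $\mathcal{Q}$ (i.e. $\mathcal{I}(10) = \mathcal{O}(10)$) but not every tree monomial involving two occurrences of $\phi$ is zero.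 *)

theory Defs
  imports
    "HOL-Computational_Algebra.Computational_Algebra"
    "HOL-Library.Poly_Mapping"
begin

text \<open>The unary tree \<open>Leaf\<close> is the operad identity; \<open>Node\<close> is an internal node
  labelled by the quaternary generator.\<close>

datatype qtree = Leaf | Node qtree qtree qtree qtree

fun leaves :: "qtree \<Rightarrow> nat" where
  "leaves Leaf = 1"
| "leaves (Node a b c d) = leaves a + leaves b + leaves c + leaves d"

fun weight :: "qtree \<Rightarrow> nat" where
  "weight Leaf = 0"
| "weight (Node a b c d) = Suc (weight a + weight b + weight c + weight d)"

text \<open>\<open>graft t i s\<close> substitutes \<open>s\<close> for the \<open>i\<close>-th leaf of \<open>t\<close>, counting leaves from left to
  right and starting at 1; the value is only meaningful for \<open>1 \<le> i \<le> leaves t\<close>.\<close>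

fun graft :: "qtree \<Rightarrow> nat \<Rightarrow> qtree \<Rightarrow> qtree" where
  "graft Leaf i s = s"
| "graft (Node a b c d) i s =
    (if i \<le> leaves a then Node (graft a i s) b c d
     else if i \<le> leaves a + leaves b then Node a (graft b (i - leaves a) s) c d
     else if i \<le> leaves a + leaves b + leaves c
       then Node a b (graft c (i - (leaves a + leaves b)) s) d
     else Node a b c (graft d (i - (leaves a + leaves b + leaves c)) s))"

text \<open>The underlying space of the operad is the direct sum of its components, i.e. the finitely
  supported functions on trees.\<close>

definition scale :: "'a::field \<Rightarrow> (qtree \<Rightarrow>\<^sub>0 'a) \<Rightarrow> (qtree \<Rightarrow>\<^sub>0 'a)" where
  "scale c x = Poly_Mapping.map ((*) c) x"

lemma lookup_scale: "Poly_Mapping.lookup (scale c x) t = c * Poly_Mapping.lookup x t"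
  by (simp add: scale_def Poly_Mapping.map.rep_eq when_def)

global_interpretation opd: vector_space "scale :: 'a::field \<Rightarrow> (qtree \<Rightarrow>\<^sub>0 'a) \<Rightarrow> (qtree \<Rightarrow>\<^sub>0 'a)"
  by unfold_locales
    (auto intro!: poly_mapping_eqI simp: lookup_scale lookup_add algebra_simps)

definition arity_space :: "nat \<Rightarrow> (qtree \<Rightarrow>\<^sub>0 'a::field) set" where
  "arity_space k = {x. \<forall>t\<in>Poly_Mapping.keys x. leaves t = k}"

definition tree_monomial :: "qtree \<Rightarrow> (qtree \<Rightarrow>\<^sub>0 'a::field)" where
  "tree_monomial t = Poly_Mapping.single t 1"

definition pcomp ::
    "(qtree \<Rightarrow>\<^sub>0 'a::field) \<Rightarrow> nat \<Rightarrow> (qtree \<Rightarrow>\<^sub>0 'a) \<Rightarrow> (qtree \<Rightarrow>\<^sub>0 'a)" where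
  "pcomp x i y =
    (\<Sum>s\<in>Poly_Mapping.keys x. \<Sum>t\<in>Poly_Mapping.keys y.
      scale (Poly_Mapping.lookup x s * Poly_Mapping.lookup y t)
        (tree_monomial (graft s i t)))"

definition generator :: "qtree \<Rightarrow>\<^sub>0 'a::field" where
  "generator = tree_monomial (Node Leaf Leaf Leaf Leaf)"

text \<open>Partial compositions are only defined between homogeneous elements.\<close>

definition operad_ideal :: "(qtree \<Rightarrow>\<^sub>0 'a::field) set \<Rightarrow> bool" where
  "operad_ideal J \<longleftrightarrow> opd.subspace J \<and>
    (\<forall>k l i x y. x \<in> arity_space k \<and> y \<in> arity_space l \<and> 1 \<le> i \<and> i \<le> k \<longrightarrow>
      (x \<in> J \<longrightarrow> pcomp x i y \<in> J) \<and> (y \<in> J \<longrightarrow> pcomp x i y \<in> J))"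

definition ideal_gen :: "(qtree \<Rightarrow>\<^sub>0 'a::field) set \<Rightarrow> (qtree \<Rightarrow>\<^sub>0 'a) set" where
  "ideal_gen R = \<Inter> {J. operad_ideal J \<and> R \<subseteq> J}"

text \<open>The cubic consequences of \<open>R\<close> span the arity 10 part of the ideal.\<close>

definition cubic_rank :: "(qtree \<Rightarrow>\<^sub>0 'a::field) set \<Rightarrow> nat" where
  "cubic_rank R = opd.dim (ideal_gen R \<inter> arity_space 10)"

definition quotient_class ::
    "(qtree \<Rightarrow>\<^sub>0 'a::field) set \<Rightarrow> (qtree \<Rightarrow>\<^sub>0 'a) \<Rightarrow> (qtree \<Rightarrow>\<^sub>0 'a) set" where
  "quotient_class J x = {y. y - x \<in> J}"

definition quotient_nilpotent_of_index :: "(qtree \<Rightarrow>\<^sub>0 'a::field) set \<Rightarrow> nat \<Rightarrow> bool" where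
  "quotient_nilpotent_of_index J n \<longleftrightarrow>
    (\<forall>t. weight t = n \<longrightarrow> quotient_class J (tree_monomial t) = quotient_class J 0) \<and>
    (\<exists>t. Suc (weight t) = n \<and> quotient_class J (tree_monomial t) \<noteq> quotient_class J 0)"

definition quadratic_relation_line :: "(qtree \<Rightarrow>\<^sub>0 'a::field) set \<Rightarrow> bool" where
  "quadratic_relation_line R \<longleftrightarrow> opd.subspace R \<and> R \<subseteq> arity_space 7 \<and> opd.dim R = 1"

definition quad :: "nat \<Rightarrow> (qtree \<Rightarrow>\<^sub>0 'a::field)" where
  "quad i = pcomp generator i generator"

definition special_relations :: "(qtree \<Rightarrow>\<^sub>0 'a::field) set" where
  "special_relations =
    {quad 1,
     quad 1 - quad 4,
     quad 1 - quad 2 + quad 3 - quad 4} \<union>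
    {quad 1 + scale \<alpha> (quad 2) + scale (\<alpha>\<^sup>2) (quad 3) - quad 4 | \<alpha>. \<alpha>\<^sup>2 - \<alpha> + 1 = 0} \<union>
    {quad 2, quad 3, quad 4}"

end

theory Submission
  imports Defs
begin

text \<open>Write \<open>\<rho> = a \<phi>\<circ>\<^sub>1\<phi> + b \<phi>\<circ>\<^sub>2\<phi> + c \<phi>\<circ>\<^sub>3\<phi> + d \<phi>\<circ>\<^sub>4\<phi>\<close> with leading coefficient 1. In a linear relation between
  the 11 cubic consequences of \<open>\<rho>\<close>, the 22 coefficient equations express all coefficients through a
  single one, so the rank is at least 10. The remaining equations have a nonzero solution only in the
  special cases: for \<open>a = 1\<close> they amount to \<open>b = c = 0\<close> and \<open>d \<in> {0, -1}\<close>, or \<open>d = -1\<close>, \<open>c = b\<^sup>2\<close> and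
  \<open>b\<^sup>3 = -1\<close>. Since the rank is at most 11, the 22 cubic tree monomials cannot all lie in the ideal.\<close>

section \<open>Spans of finite families\<close>

text \<open>Independence is stated for an indexed family, since distinct indices might carry equal
  vectors. A coincidence \<open>v i = v j\<close> would give the nontrivial relation with
  coefficients 1 and -1, so \<open>v\<close> is injective on \<open>I\<close> and indices may be
  counted instead of vectors.\<close>

lemma (in vector_space) dim_span_family:
  assumes fin: "finite I"
    and ind: "\<And>c. (\<Sum>i\<in>I. scale (c i) (v i)) = 0 \<Longrightarrow> \<forall>i\<in>I. c i = 0"
  shows "dim (span (v ` I)) = card I"
proof -
  have inj: "inj_on v I"
  proof (rule inj_onI, rule ccontr)
    fix i j assume ij: "i \<in> I" "j \<in> I" "v i = v j" "i \<noteq> j"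
    define c where "c = (\<lambda>k. if k = i then 1 else if k = j then - 1 else 0 :: 'a)"
    have "(\<Sum>k\<in>I. scale (c k) (v k)) = (\<Sum>k\<in>{i, j}. scale (c k) (v k))"
      using ij fin by (intro sum.mono_neutral_right) (auto simp: c_def)
    also have "\<dots> = 0"
      using ij by (simp add: c_def)
    finally show False
      using ind[of c] ij by (auto simp: c_def)
  qed
  have "independent (v ` I)"
    unfolding dependent_finite[OF finite_imageI[OF fin]]
  proof safe
    fix u i assume "i \<in> I" "u (v i) \<noteq> 0" "(\<Sum>w\<in>v ` I. scale (u w) w) = 0"
    then show False
      using ind[of "\<lambda>i. u (v i)"] by (simp add: sum.reindex[OF inj])
  qed
  then show ?thesis
    by (simp add: dim_eq_card_independent card_image[OF inj])
qed

text \<open>A relation with nonzero coefficient at \<open>k\<close> can be solved for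
  \<open>v k\<close>, so one member of a dependent family is dropped without changing the
  span.\<close>

lemma (in vector_space) span_family_remove:
  assumes fin: "finite I" and k: "k \<in> I" and nz: "c k \<noteq> 0"
    and rel: "(\<Sum>i\<in>I. scale (c i) (v i)) = 0"
  shows "span (v ` I) = span (v ` (I - {k}))"
proof -
  have "scale (c k) (v k) = - (\<Sum>i\<in>I - {k}. scale (c i) (v i))"
    using rel by (simp add: sum.remove[OF fin k] eq_neg_iff_add_eq_0)
  also have "\<dots> \<in> span (v ` (I - {k}))"
    by (intro span_neg span_sum span_scale span_base) auto
  finally have "scale (c k) (v k) \<in> span (v ` (I - {k}))" .
  then have "scale (inverse (c k)) (scale (c k) (v k)) \<in> span (v ` (I - {k}))"
    by (rule span_scale)
  then have "v k \<in> span (v ` (I - {k}))"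
    using nz by simp
  moreover have "v ` I = insert (v k) (v ` (I - {k}))"
    using k by auto
  ultimately show ?thesis
    by (simp add: span_redundant)
qed

section \<open>Trees and partial composition\<close>

text \<open>Each internal node trades one leaf for four. Hence arity determines weight, and only
  arities congruent to 1 modulo 3 occur: 7 means two generators, 10 means three.\<close>

lemma leaves_eq_weight: "leaves t = 3 * weight t + 1"
  by (induction t) auto

lemma leaves_graft:
  "1 \<le> i \<Longrightarrow> i \<le> leaves s \<Longrightarrow> leaves (graft s i t) + 1 = leaves s + leaves t"
  by (induction s arbitrary: i) auto

lemma graft_Leaf_right: "graft s i Leaf = s"
  by (induction s arbitrary: i) auto

abbreviation corolla :: qtree where
  "corolla \<equiv> Node Leaf Leaf Leaf Leaf"

lemma weight_eq_0: "weight t = 0 \<longleftrightarrow> t = Leaf"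
  by (cases t) auto

lemma weight_eq_1: "weight t = 1 \<longleftrightarrow> t = corolla"
  by (cases t) (auto simp: weight_eq_0)

lemma weight_eq_2:
  "weight t = 2 \<longleftrightarrow> t \<in> {Node corolla Leaf Leaf Leaf, Node Leaf corolla Leaf Leaf,
     Node Leaf Leaf corolla Leaf, Node Leaf Leaf Leaf corolla}"
proof (cases t)
  case (Node a b c d)
  show ?thesis
    unfolding Node
    by (auto simp: weight_eq_0 weight_eq_1[unfolded One_nat_def] add_is_1 numeral_2_eq_2)
qed simp

section \<open>Partial composition as the bilinear extension of grafting\<close>

lemma lookup_tree_monomial:
  "Poly_Mapping.lookup (tree_monomial s) t = (if s = t then 1 else 0)"
  by (simp add: tree_monomial_def lookup_single when_def)

text \<open>The sums defining \<open>pcomp\<close> run over supports, which change under addition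
  and scaling. Enlarging them only adds zero terms, so several compositions can be compared over one
  common index set; bilinearity follows.\<close>

lemma pcomp_superset:
  assumes "finite A" "finite B" "Poly_Mapping.keys x \<subseteq> A" "Poly_Mapping.keys y \<subseteq> B"
  shows "pcomp x i y = (\<Sum>s\<in>A. \<Sum>t\<in>B.
      scale (Poly_Mapping.lookup x s * Poly_Mapping.lookup y t) (tree_monomial (graft s i t)))"
proof -
  have "pcomp x i y = (\<Sum>s\<in>Poly_Mapping.keys x. \<Sum>t\<in>B.
      scale (Poly_Mapping.lookup x s * Poly_Mapping.lookup y t) (tree_monomial (graft s i t)))"
    unfolding pcomp_def
    by (intro sum.cong refl sum.mono_neutral_left) (use assms in \<open>auto simp: in_keys_iff\<close>)
  also have "\<dots> = (\<Sum>s\<in>A. \<Sum>t\<in>B.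
      scale (Poly_Mapping.lookup x s * Poly_Mapping.lookup y t) (tree_monomial (graft s i t)))"
    by (intro sum.mono_neutral_left) (use assms in \<open>auto simp: in_keys_iff\<close>)
  finally show ?thesis .
qed

lemma keys_scale_subset: "Poly_Mapping.keys (scale c x) \<subseteq> Poly_Mapping.keys x"
  by (auto simp: in_keys_iff lookup_scale)

lemma pcomp_add_left: "pcomp (x + x') i y = pcomp x i y + pcomp x' i y"
proof -
  have K: "finite (Poly_Mapping.keys x \<union> Poly_Mapping.keys x')" "finite (Poly_Mapping.keys y)"
    by auto
  show ?thesis
    unfolding pcomp_superset[OF K Poly_Mapping.keys_add order_refl]
      pcomp_superset[OF K Un_upper1 order_refl] pcomp_superset[OF K Un_upper2 order_refl]
    by (simp add: lookup_add distrib_right opd.scale_left_distrib sum.distrib)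
qed

lemma pcomp_add_right: "pcomp x i (y + y') = pcomp x i y + pcomp x i y'"
proof -
  have K: "finite (Poly_Mapping.keys x)" "finite (Poly_Mapping.keys y \<union> Poly_Mapping.keys y')"
    by auto
  show ?thesis
    unfolding pcomp_superset[OF K order_refl Poly_Mapping.keys_add]
      pcomp_superset[OF K order_refl Un_upper1] pcomp_superset[OF K order_refl Un_upper2]
    by (simp add: lookup_add distrib_left opd.scale_left_distrib sum.distrib)
qed

lemma pcomp_scale_left: "pcomp (scale c x) i y = scale c (pcomp x i y)"
  by (subst pcomp_superset[OF _ _ keys_scale_subset order_refl])
    (simp_all add: pcomp_def lookup_scale opd.scale_sum_right mult.assoc)

lemma pcomp_scale_right: "pcomp x i (scale c y) = scale c (pcomp x i y)"
  by (subst pcomp_superset[OF _ _ order_refl keys_scale_subset])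
    (simp_all add: pcomp_def lookup_scale opd.scale_sum_right mult_ac)

lemma pcomp_zero [simp]: "pcomp 0 i y = 0" "pcomp x i 0 = 0"
  by (simp_all add: pcomp_def)

lemma pcomp_tree_monomial:
  "pcomp (tree_monomial s) i (tree_monomial t) = tree_monomial (graft s i t)"
  by (subst pcomp_superset[of "{s}" "{t}"]) (auto simp: tree_monomial_def)

lemma sum_tree_monomials:
  "(\<Sum>t\<in>Poly_Mapping.keys x. scale (Poly_Mapping.lookup x t) (tree_monomial t)) = x"
proof (rule poly_mapping_eqI)
  fix s
  show "Poly_Mapping.lookup (\<Sum>t\<in>Poly_Mapping.keys x.
      scale (Poly_Mapping.lookup x t) (tree_monomial t)) s = Poly_Mapping.lookup x s"
    by (simp add: lookup_sum lookup_scale lookup_tree_monomial if_distrib sum.delta in_keys_iff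
        cong: if_cong)
qed

lemma pcomp_Leaf_right: "pcomp x i (tree_monomial Leaf) = x"
proof -
  have "pcomp x i (tree_monomial Leaf) =
      (\<Sum>t\<in>Poly_Mapping.keys x. scale (Poly_Mapping.lookup x t) (tree_monomial t))"
    by (subst pcomp_superset[of "Poly_Mapping.keys x" "{Leaf}"])
      (auto simp: tree_monomial_def graft_Leaf_right)
  then show ?thesis
    by (simp add: sum_tree_monomials)
qed

lemma pcomp_Leaf_left: "pcomp (tree_monomial Leaf) i x = x"
proof -
  have "pcomp (tree_monomial Leaf) i x =
      (\<Sum>t\<in>Poly_Mapping.keys x. scale (Poly_Mapping.lookup x t) (tree_monomial t))"
    by (subst pcomp_superset[of "{Leaf}" "Poly_Mapping.keys x"]) (auto simp: tree_monomial_def)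
  then show ?thesis
    by (simp add: sum_tree_monomials)
qed

section \<open>Homogeneous components and the smallest arities\<close>

lemma subspace_keys: "opd.subspace {x. \<forall>t\<in>Poly_Mapping.keys x. P t}"
  by (auto simp: opd.subspace_def in_keys_iff lookup_add lookup_scale)

lemma subspace_arity_space: "opd.subspace (arity_space k)"
  unfolding arity_space_def by (rule subspace_keys)

lemma tree_monomial_in_keys_space:
  "P t \<Longrightarrow> tree_monomial t \<in> {x. \<forall>t\<in>Poly_Mapping.keys x. P t}"
  by (simp add: tree_monomial_def)

lemma pcomp_in_keys_space:
  assumes "\<And>s t. s \<in> Poly_Mapping.keys x \<Longrightarrow> t \<in> Poly_Mapping.keys y \<Longrightarrow> P (graft s i t)"
  shows "\<forall>t\<in>Poly_Mapping.keys (pcomp x i y). P t"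
proof -
  have "pcomp x i y \<in> {x. \<forall>t\<in>Poly_Mapping.keys x. P t}"
    unfolding pcomp_def
    using assms by (intro opd.subspace_sum opd.subspace_scale subspace_keys tree_monomial_in_keys_space)
  then show ?thesis by simp
qed

lemma pcomp_arity:
  assumes "x \<in> arity_space k" "y \<in> arity_space l" "1 \<le> i" "i \<le> k"
  shows "pcomp x i y \<in> arity_space (k + l - 1)"
  unfolding arity_space_def mem_Collect_eq
proof (rule pcomp_in_keys_space)
  fix s t assume "s \<in> Poly_Mapping.keys x" "t \<in> Poly_Mapping.keys y"
  with assms have "leaves s = k" "leaves t = l"
    by (auto simp: arity_space_def)
  with leaves_graft[of i s t] assms show "leaves (graft s i t) = k + l - 1"
    by simp
qed

lemma arity_space_trivial:
  assumes "x \<in> arity_space k" "x \<noteq> 0"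
  obtains n where "k = 3 * n + 1"
  using assms by (auto simp: arity_space_def leaves_eq_weight simp flip: keys_eq_empty)

lemma eq_scale_tree_monomial:
  assumes "\<And>s. s \<in> Poly_Mapping.keys x \<Longrightarrow> s = t"
  shows "x = scale (Poly_Mapping.lookup x t) (tree_monomial t)"
proof (rule poly_mapping_eqI)
  fix s
  show "Poly_Mapping.lookup x s =
      Poly_Mapping.lookup (scale (Poly_Mapping.lookup x t) (tree_monomial t)) s"
    using assms[of s] by (auto simp: lookup_scale lookup_tree_monomial in_keys_iff)
qed

lemma arity_space_1:
  assumes "x \<in> arity_space 1"
  obtains c where "x = scale c (tree_monomial Leaf)"
  using assms eq_scale_tree_monomial[of x Leaf]
  by (auto simp: arity_space_def leaves_eq_weight weight_eq_0)

lemma arity_space_4: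
  assumes "x \<in> arity_space 4"
  obtains c where "x = scale c generator"
proof -
  have "s = corolla" if "s \<in> Poly_Mapping.keys x" for s
    using assms that by (simp add: arity_space_def leaves_eq_weight flip: weight_eq_1)
  then show ?thesis
    using eq_scale_tree_monomial[of x corolla] that by (auto simp: generator_def)
qed

section \<open>Coordinates on the quadratic component\<close>

lemma quad_eq:
  "quad 1 = tree_monomial (Node corolla Leaf Leaf Leaf)"
  "quad 2 = tree_monomial (Node Leaf corolla Leaf Leaf)"
  "quad 3 = tree_monomial (Node Leaf Leaf corolla Leaf)"
  "quad 4 = tree_monomial (Node Leaf Leaf Leaf corolla)"
  by (simp_all add: quad_def generator_def pcomp_tree_monomial)

definition quad_comb :: "'a::field \<Rightarrow> 'a \<Rightarrow> 'a \<Rightarrow> 'a \<Rightarrow> (qtree \<Rightarrow>\<^sub>0 'a)" where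
  "quad_comb a b c d = scale a (quad 1) + scale b (quad 2) + scale c (quad 3) + scale d (quad 4)"

lemma lookup_quad_comb:
  "Poly_Mapping.lookup (quad_comb a b c d) (Node corolla Leaf Leaf Leaf) = a"
  "Poly_Mapping.lookup (quad_comb a b c d) (Node Leaf corolla Leaf Leaf) = b"
  "Poly_Mapping.lookup (quad_comb a b c d) (Node Leaf Leaf corolla Leaf) = c"
  "Poly_Mapping.lookup (quad_comb a b c d) (Node Leaf Leaf Leaf corolla) = d"
  unfolding quad_comb_def quad_eq
  by (simp_all add: lookup_add lookup_scale lookup_tree_monomial)

lemma quad_comb_inject:
  "quad_comb a b c d = quad_comb a' b' c' d' \<longleftrightarrow> a = a' \<and> b = b' \<and> c = c' \<and> d = d'"
  by (metis lookup_quad_comb)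

lemma quad_comb_eq_0: "quad_comb a b c d = 0 \<longleftrightarrow> a = 0 \<and> b = 0 \<and> c = 0 \<and> d = 0"
  using quad_comb_inject[of a b c d 0 0 0 0] by (simp add: quad_comb_def)

lemma scale_quad_comb: "scale r (quad_comb a b c d) = quad_comb (r * a) (r * b) (r * c) (r * d)"
  by (simp add: quad_comb_def opd.scale_right_distrib)

lemma quad_comb_arity: "quad_comb a b c d \<in> arity_space 7"
  unfolding quad_comb_def quad_eq
  by (intro opd.subspace_add opd.subspace_scale subspace_arity_space)
    (simp_all add: arity_space_def tree_monomial_def)

lemma arity_space_7:
  assumes "x \<in> arity_space 7"
  obtains a b c d where "x = quad_comb a b c d"
proof -
  define y where "y = quad_comb (Poly_Mapping.lookup x (Node corolla Leaf Leaf Leaf))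
    (Poly_Mapping.lookup x (Node Leaf corolla Leaf Leaf))
    (Poly_Mapping.lookup x (Node Leaf Leaf corolla Leaf))
    (Poly_Mapping.lookup x (Node Leaf Leaf Leaf corolla))"
  have "x = y"
  proof (rule poly_mapping_eqI)
    fix t
    show "Poly_Mapping.lookup x t = Poly_Mapping.lookup y t"
    proof (cases "weight t = 2")
      case True
      then show ?thesis
        unfolding weight_eq_2 y_def by (auto simp: lookup_quad_comb)
    next
      case False
      then have "leaves t \<noteq> 7"
        by (simp add: leaves_eq_weight)
      with assms quad_comb_arity show ?thesis
        unfolding y_def arity_space_def by (metis (mono_tags, lifting) in_keys_iff mem_Collect_eq)
    qed
  qed
  with that show ?thesis
    unfolding y_def by blast
qed

section \<open>The ideal in arity 10\<close>

text \<open>Both kinds of cubic consequence share the index set 1..11, so that a linear relation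
  among them is a single coefficient function: 1..7 are the leaves of \<rho>, and 8..11 are the four
  leaves of the generator shifted by 7.\<close>

definition consequence :: "(qtree \<Rightarrow>\<^sub>0 'a::field) \<Rightarrow> nat \<Rightarrow> (qtree \<Rightarrow>\<^sub>0 'a)" where
  "consequence \<rho> i = (if i \<le> 7 then pcomp \<rho> i generator else pcomp generator (i - 7) \<rho>)"

lemma generator_arity: "generator \<in> arity_space 4"
  by (simp add: generator_def tree_monomial_def arity_space_def)

lemma consequence_arity:
  assumes "\<rho> \<in> arity_space 7" "i \<in> {1..11}"
  shows "consequence \<rho> i \<in> arity_space 10"
  using assms pcomp_arity[OF assms(1) generator_arity, of i]
    pcomp_arity[OF generator_arity assms(1), of "i - 7"]
  by (auto simp: consequence_def)

lemma subspace_ideal_gen: "opd.subspace (ideal_gen R)"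
  unfolding ideal_gen_def by (rule opd.subspace_Inter) (auto simp: operad_ideal_def)

lemma operad_idealD:
  assumes "operad_ideal J" "x \<in> arity_space k" "y \<in> arity_space l" "1 \<le> i" "i \<le> k"
  shows "x \<in> J \<Longrightarrow> pcomp x i y \<in> J" "y \<in> J \<Longrightarrow> pcomp x i y \<in> J"
  using assms unfolding operad_ideal_def by blast+

lemma consequence_in_ideal:
  assumes "\<rho> \<in> arity_space 7" "\<rho> \<in> R" "i \<in> {1..11}"
  shows "consequence \<rho> i \<in> ideal_gen R"
proof -
  have "consequence \<rho> i \<in> J" if J: "operad_ideal J" "R \<subseteq> J" for J
  proof (cases "i \<le> 7")
    case True
    then show ?thesis
      unfolding consequence_def
      using operad_idealD(1)[OF J(1) assms(1) generator_arity] J(2) assms by auto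
  next
    case False
    then have "1 \<le> i - 7" "i - 7 \<le> 4"
      using assms by auto
    with False show ?thesis
      unfolding consequence_def
      using operad_idealD(2)[OF J(1) generator_arity assms(1)] J(2) assms by auto
  qed
  then show ?thesis
    by (auto simp: ideal_gen_def)
qed

text \<open>An explicit ideal that agrees with the generated one up to arity 10 and contains everything
  in higher arities.\<close>

definition truncated_ideal :: "(qtree \<Rightarrow>\<^sub>0 'a::field) \<Rightarrow> (qtree \<Rightarrow>\<^sub>0 'a) set" where
  "truncated_ideal \<rho> = {u + v + w | u v w. u \<in> opd.span {\<rho>} \<and>
     v \<in> opd.span (consequence \<rho> ` {1..11}) \<and> (\<forall>t\<in>Poly_Mapping.keys w. 10 < leaves t)}"

lemma subspace_truncated_ideal: "opd.subspace (truncated_ideal \<rho>)"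
proof -
  have "truncated_ideal \<rho> = {x + w | x w. x \<in> {u + v | u v. u \<in> opd.span {\<rho>} \<and>
     v \<in> opd.span (consequence \<rho> ` {1..11})} \<and> w \<in> {w. \<forall>t\<in>Poly_Mapping.keys w. 10 < leaves t}}"
    unfolding truncated_ideal_def by blast
  then show ?thesis
    by (simp only:) (intro opd.subspace_sums opd.subspace_span subspace_keys)
qed

lemma truncated_idealI:
  "u \<in> opd.span {\<rho>} \<Longrightarrow> u \<in> truncated_ideal \<rho>"
  "v \<in> opd.span (consequence \<rho> ` {1..11}) \<Longrightarrow> v \<in> truncated_ideal \<rho>"
  "\<forall>t\<in>Poly_Mapping.keys w. 10 < leaves t \<Longrightarrow> w \<in> truncated_ideal \<rho>"
proof -
  assume "u \<in> opd.span {\<rho>}"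
  then show "u \<in> truncated_ideal \<rho>"
    unfolding truncated_ideal_def mem_Collect_eq
    by (intro exI[of _ u] exI[of _ 0]) (auto simp: opd.span_zero)
next
  assume "v \<in> opd.span (consequence \<rho> ` {1..11})"
  then show "v \<in> truncated_ideal \<rho>"
    unfolding truncated_ideal_def mem_Collect_eq
    by (intro exI[of _ 0] exI[of _ v]) (auto simp: opd.span_zero)
next
  assume "\<forall>t\<in>Poly_Mapping.keys w. 10 < leaves t"
  then show "w \<in> truncated_ideal \<rho>"
    unfolding truncated_ideal_def mem_Collect_eq
    by (intro exI[of _ 0] exI[of _ w]) (auto simp: opd.span_zero)
qed

text \<open>The three summands are supported in arity 7, arity 10 and arities above 10. These ranges
  are disjoint, so comparing coefficients tree by tree identifies a homogeneous element with one
  summand or with 0.\<close>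

lemma truncated_ideal_homogeneous:
  assumes \<rho>: "\<rho> \<in> arity_space 7" and x: "x \<in> truncated_ideal \<rho>" "x \<in> arity_space k"
  shows "x = 0 \<or> k = 7 \<and> x \<in> opd.span {\<rho>} \<or>
    k = 10 \<and> x \<in> opd.span (consequence \<rho> ` {1..11}) \<or> 10 < k"
proof -
  obtain u v w where xeq: "x = u + v + w" and u: "u \<in> opd.span {\<rho>}"
    and v: "v \<in> opd.span (consequence \<rho> ` {1..11})"
    and w: "\<forall>t\<in>Poly_Mapping.keys w. 10 < leaves t"
    using x(1) unfolding truncated_ideal_def by blast
  have "u \<in> arity_space 7"
    using u \<rho> opd.span_minimal[OF _ subspace_arity_space, of "{\<rho>}" 7] by auto
  then have u0: "Poly_Mapping.lookup u t = 0" if "leaves t \<noteq> 7" for t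
    using that by (auto simp: arity_space_def in_keys_iff)
  have "v \<in> arity_space 10"
    using v consequence_arity[OF \<rho>]
      opd.span_minimal[OF _ subspace_arity_space, of "consequence \<rho> ` {1..11}" 10] by blast
  then have v0: "Poly_Mapping.lookup v t = 0" if "leaves t \<noteq> 10" for t
    using that by (auto simp: arity_space_def in_keys_iff)
  have w0: "Poly_Mapping.lookup w t = 0" if "leaves t \<le> 10" for t
    using that w by (meson in_keys_iff leD)
  have x0: "Poly_Mapping.lookup x t = 0" if "leaves t \<noteq> k" for t
    using that x(2) by (auto simp: arity_space_def in_keys_iff)
  have look: "Poly_Mapping.lookup x t = Poly_Mapping.lookup u t + Poly_Mapping.lookup v t
      + Poly_Mapping.lookup w t" for t
    by (simp add: xeq lookup_add)
  consider "k = 7" | "k = 10" | "10 < k" | "k < 10" "k \<noteq> 7"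
    by linarith
  then show ?thesis
  proof cases
    case 1
    have "x = u"
    proof (rule poly_mapping_eqI)
      fix t show "Poly_Mapping.lookup x t = Poly_Mapping.lookup u t"
        using look[of t] x0[of t] u0[of t] v0[of t] w0[of t] 1 by (cases "leaves t = 7") auto
    qed
    with u 1 show ?thesis by simp
  next
    case 2
    have "x = v"
    proof (rule poly_mapping_eqI)
      fix t show "Poly_Mapping.lookup x t = Poly_Mapping.lookup v t"
        using look[of t] x0[of t] u0[of t] v0[of t] w0[of t] 2 by (cases "leaves t = 10") auto
    qed
    with v 2 show ?thesis by simp
  next
    case 4
    have "x = 0"
    proof (rule poly_mapping_eqI)
      fix t show "Poly_Mapping.lookup x t = Poly_Mapping.lookup 0 t"
        using look[of t] x0[of t] u0[of t] v0[of t] w0[of t] 4 by (cases "leaves t = k") auto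
    qed
    then show ?thesis by simp
  qed simp
qed

text \<open>The composite has arity \<open>k + l - 1\<close>, which exceeds 10 exactly under the
  last hypothesis.\<close>

lemma pcomp_in_truncated_ideal_high:
  assumes "x \<in> arity_space k" "y \<in> arity_space l" "1 \<le> i" "i \<le> k" "11 < k + l"
  shows "pcomp x i y \<in> truncated_ideal \<rho>"
  using pcomp_arity[OF assms(1-4)] assms(5)
  by (intro truncated_idealI(3)) (auto simp: arity_space_def)

text \<open>Below the cutoff, composing with arity 1 only rescales, and composing a multiple of
  \<rho> with a multiple of the generator gives a multiple of a consequence. Every other nonzero
  composite lands above arity 10, where the set contains everything.\<close>

lemma operad_ideal_truncated_ideal:
  assumes \<rho>: "\<rho> \<in> arity_space 7"
  shows "operad_ideal (truncated_ideal \<rho>)"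
  unfolding operad_ideal_def
proof (intro conjI allI impI subspace_truncated_ideal)
  fix k l i and x y :: "qtree \<Rightarrow>\<^sub>0 'a"
  assume "x \<in> arity_space k \<and> y \<in> arity_space l \<and> 1 \<le> i \<and> i \<le> k"
  then have xy: "x \<in> arity_space k" "y \<in> arity_space l" "1 \<le> i" "i \<le> k"
    by auto
  note zero = opd.subspace_0[OF subspace_truncated_ideal]
  note sc = opd.subspace_scale[OF subspace_truncated_ideal]
  { assume x: "x \<in> truncated_ideal \<rho>"
    show "pcomp x i y \<in> truncated_ideal \<rho>"
    proof (cases "x = 0 \<or> y = 0 \<or> 11 < k + l")
      case True
      with zero pcomp_in_truncated_ideal_high[OF xy] show ?thesis by auto
    next
      case False
      \<comment> \<open>A nonzero \<open>y\<close> has arity 1 modulo 3. A nonzero \<open>x\<close>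
        in the set has arity 7, 10 or more, so the bound \<open>k + l \<le> 11\<close> leaves only
        \<open>l = 1\<close> and the pair \<open>k = 7\<close>, \<open>l = 4\<close>.\<close>
      then obtain n where l: "l = 3 * n + 1"
        using xy(2) arity_space_trivial by blast
      from False truncated_ideal_homogeneous[OF \<rho> x xy(1)]
      consider "l = 1" | "l = 4" "k = 7" "x \<in> opd.span {\<rho>}"
        unfolding l by fastforce
      then show ?thesis
      proof cases
        case 1
        then obtain r where "y = scale r (tree_monomial Leaf)"
          using xy(2) arity_space_1 by blast
        then show ?thesis
          using x sc by (simp add: pcomp_scale_right pcomp_Leaf_right)
      next
        case 2
        obtain r s where "x = scale r \<rho>" "y = scale s generator"
          using 2 xy(2) by (auto elim!: arity_space_4 simp: opd.span_singleton)
        moreover have "consequence \<rho> i \<in> truncated_ideal \<rho>"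
          using xy 2 by (intro truncated_idealI(2) opd.span_base) auto
        ultimately show ?thesis
          using sc xy 2 by (auto simp: pcomp_scale_left pcomp_scale_right consequence_def)
      qed
    qed }
  { assume y: "y \<in> truncated_ideal \<rho>"
    show "pcomp x i y \<in> truncated_ideal \<rho>"
    proof (cases "x = 0 \<or> y = 0 \<or> 11 < k + l")
      case True
      with zero pcomp_in_truncated_ideal_high[OF xy] show ?thesis by auto
    next
      case False
      then obtain n where k: "k = 3 * n + 1"
        using xy(1) arity_space_trivial by blast
      from False truncated_ideal_homogeneous[OF \<rho> y xy(2)]
      consider "k = 1" | "k = 4" "l = 7" "y \<in> opd.span {\<rho>}"
        unfolding k by fastforce
      then show ?thesis
      proof cases
        case 1
        then obtain r where "x = scale r (tree_monomial Leaf)"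
          using xy(1) arity_space_1 by blast
        then show ?thesis
          using y sc by (simp add: pcomp_scale_left pcomp_Leaf_left)
      next
        case 2
        obtain r s where "y = scale r \<rho>" "x = scale s generator"
          using 2 xy(1) by (auto elim!: arity_space_4 simp: opd.span_singleton)
        \<comment> \<open>Compositions with \<rho> on the right are numbered from 8 on, and
          \<open>i\<close> is at most 4 here.\<close>
        moreover have "consequence \<rho> (i + 7) \<in> truncated_ideal \<rho>"
          using xy 2 by (intro truncated_idealI(2) opd.span_base) auto
        ultimately show ?thesis
          using sc xy 2 by (auto simp: pcomp_scale_left pcomp_scale_right consequence_def)
      qed
    qed }
qed

text \<open>The truncated ideal is an operad ideal containing \<rho>, so it bounds the generated
  ideal from above, and its arity 10 part is the span of the consequences. Conversely, every ideal
  containing \<rho> contains the consequences.\<close>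

lemma ideal_gen_arity_10:
  assumes \<rho>: "\<rho> \<in> arity_space 7"
  shows "ideal_gen (opd.span {\<rho>}) \<inter> arity_space 10 = opd.span (consequence \<rho> ` {1..11})"
proof
  show "ideal_gen (opd.span {\<rho>}) \<inter> arity_space 10 \<subseteq> opd.span (consequence \<rho> ` {1..11})"
  proof
    fix x assume x: "x \<in> ideal_gen (opd.span {\<rho>}) \<inter> arity_space 10"
    then have "x \<in> truncated_ideal \<rho>"
      using operad_ideal_truncated_ideal[OF \<rho>] truncated_idealI(1) unfolding ideal_gen_def by blast
    with truncated_ideal_homogeneous[OF \<rho>, of x 10] x
    show "x \<in> opd.span (consequence \<rho> ` {1..11})"
      by (auto simp: opd.span_zero)
  qed
  show "opd.span (consequence \<rho> ` {1..11}) \<subseteq> ideal_gen (opd.span {\<rho>}) \<inter> arity_space 10"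
    using consequence_arity[OF \<rho>] consequence_in_ideal[OF \<rho>]
    by (intro opd.span_minimal opd.subspace_inter subspace_ideal_gen subspace_arity_space)
      (auto simp: opd.span_base)
qed

section \<open>Linear relations between the consequences\<close>

lemma consequence_quad_comb:
  "consequence (quad_comb a b c d) i =
    (if i \<le> 7 then
       scale a (tree_monomial (graft (Node corolla Leaf Leaf Leaf) i corolla)) +
       scale b (tree_monomial (graft (Node Leaf corolla Leaf Leaf) i corolla)) +
       scale c (tree_monomial (graft (Node Leaf Leaf corolla Leaf) i corolla)) +
       scale d (tree_monomial (graft (Node Leaf Leaf Leaf corolla) i corolla))
     else
       scale a (tree_monomial (graft corolla (i - 7) (Node corolla Leaf Leaf Leaf))) +
       scale b (tree_monomial (graft corolla (i - 7) (Node Leaf corolla Leaf Leaf))) +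
       scale c (tree_monomial (graft corolla (i - 7) (Node Leaf Leaf corolla Leaf))) +
       scale d (tree_monomial (graft corolla (i - 7) (Node Leaf Leaf Leaf corolla))))"
  unfolding consequence_def quad_comb_def quad_eq
  by (simp add: generator_def pcomp_add_left pcomp_add_right
      pcomp_scale_left pcomp_scale_right pcomp_tree_monomial)

lemma atLeastAtMost_1_11: "{1..11::nat} = {1, 2, 3, 4, 5, 6, 7, 8, 9, 10, 11}"
  unfolding set_eq_iff atLeastAtMost_iff insert_iff empty_iff by presburger

text \<open>A tree with three internal nodes has two internal edges. Choosing an edge selects the
  two-node subtree that comes from a monomial of \<rho>, and the third node is the added generator.
  Hence each of the 22 coefficients has exactly two terms, 44 = 11 * 4 in all.\<close>

lemma sum_consequences:
  "(\<Sum>i\<in>{1..11}. scale (x i) (consequence (quad_comb a b c d) i)) =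
      scale (x 1 * a + x 8 * a) (tree_monomial (Node (Node corolla Leaf Leaf Leaf) Leaf Leaf Leaf)) +
      scale (x 2 * a + x 8 * b) (tree_monomial (Node (Node Leaf corolla Leaf Leaf) Leaf Leaf Leaf)) +
      scale (x 3 * a + x 8 * c) (tree_monomial (Node (Node Leaf Leaf corolla Leaf) Leaf Leaf Leaf)) +
      scale (x 4 * a + x 8 * d) (tree_monomial (Node (Node Leaf Leaf Leaf corolla) Leaf Leaf Leaf)) +
      scale (x 1 * b + x 5 * a) (tree_monomial (Node corolla corolla Leaf Leaf)) +
      scale (x 1 * c + x 6 * a) (tree_monomial (Node corolla Leaf corolla Leaf)) +
      scale (x 1 * d + x 7 * a) (tree_monomial (Node corolla Leaf Leaf corolla)) +
      scale (x 2 * b + x 9 * a) (tree_monomial (Node Leaf (Node corolla Leaf Leaf Leaf) Leaf Leaf)) +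
      scale (x 3 * b + x 9 * b) (tree_monomial (Node Leaf (Node Leaf corolla Leaf Leaf) Leaf Leaf)) +
      scale (x 4 * b + x 9 * c) (tree_monomial (Node Leaf (Node Leaf Leaf corolla Leaf) Leaf Leaf)) +
      scale (x 5 * b + x 9 * d) (tree_monomial (Node Leaf (Node Leaf Leaf Leaf corolla) Leaf Leaf)) +
      scale (x 2 * c + x 6 * b) (tree_monomial (Node Leaf corolla corolla Leaf)) +
      scale (x 2 * d + x 7 * b) (tree_monomial (Node Leaf corolla Leaf corolla)) +
      scale (x 3 * c + x 10 * a) (tree_monomial (Node Leaf Leaf (Node corolla Leaf Leaf Leaf) Leaf)) +
      scale (x 4 * c + x 10 * b) (tree_monomial (Node Leaf Leaf (Node Leaf corolla Leaf Leaf) Leaf)) +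
      scale (x 5 * c + x 10 * c) (tree_monomial (Node Leaf Leaf (Node Leaf Leaf corolla Leaf) Leaf)) +
      scale (x 6 * c + x 10 * d) (tree_monomial (Node Leaf Leaf (Node Leaf Leaf Leaf corolla) Leaf)) +
      scale (x 3 * d + x 7 * c) (tree_monomial (Node Leaf Leaf corolla corolla)) +
      scale (x 4 * d + x 11 * a) (tree_monomial (Node Leaf Leaf Leaf (Node corolla Leaf Leaf Leaf))) +
      scale (x 5 * d + x 11 * b) (tree_monomial (Node Leaf Leaf Leaf (Node Leaf corolla Leaf Leaf))) +
      scale (x 6 * d + x 11 * c) (tree_monomial (Node Leaf Leaf Leaf (Node Leaf Leaf corolla Leaf))) +
      scale (x 7 * d + x 11 * d) (tree_monomial (Node Leaf Leaf Leaf (Node Leaf Leaf Leaf corolla)))" (is "_ = ?S")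
proof (rule poly_mapping_eqI)
  fix t
  show "Poly_Mapping.lookup
      (\<Sum>i\<in>{1..11}. scale (x i) (consequence (quad_comb a b c d) i)) t = Poly_Mapping.lookup ?S t"
    unfolding atLeastAtMost_1_11
    by (simp add: consequence_quad_comb lookup_add lookup_scale algebra_simps)
qed

lemma relation_iff:
  "(\<Sum>i\<in>{1..11}. scale (x i) (consequence (quad_comb a b c d) i)) = 0 \<longleftrightarrow>
    x 1 * a + x 8 * a = 0 \<and>
    x 2 * a + x 8 * b = 0 \<and>
    x 3 * a + x 8 * c = 0 \<and>
    x 4 * a + x 8 * d = 0 \<and>
    x 1 * b + x 5 * a = 0 \<and>
    x 1 * c + x 6 * a = 0 \<and>
    x 1 * d + x 7 * a = 0 \<and>
    x 2 * b + x 9 * a = 0 \<and>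
    x 3 * b + x 9 * b = 0 \<and>
    x 4 * b + x 9 * c = 0 \<and>
    x 5 * b + x 9 * d = 0 \<and>
    x 2 * c + x 6 * b = 0 \<and>
    x 2 * d + x 7 * b = 0 \<and>
    x 3 * c + x 10 * a = 0 \<and>
    x 4 * c + x 10 * b = 0 \<and>
    x 5 * c + x 10 * c = 0 \<and>
    x 6 * c + x 10 * d = 0 \<and>
    x 3 * d + x 7 * c = 0 \<and>
    x 4 * d + x 11 * a = 0 \<and>
    x 5 * d + x 11 * b = 0 \<and>
    x 6 * d + x 11 * c = 0 \<and>
    x 7 * d + x 11 * d = 0" (is "_ \<longleftrightarrow> ?R")
proof
  let ?S = "\<Sum>i\<in>{1..11}. scale (x i) (consequence (quad_comb a b c d) i)"
  have
    "Poly_Mapping.lookup ?S (Node (Node corolla Leaf Leaf Leaf) Leaf Leaf Leaf) = x 1 * a + x 8 * a"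
    "Poly_Mapping.lookup ?S (Node (Node Leaf corolla Leaf Leaf) Leaf Leaf Leaf) = x 2 * a + x 8 * b"
    "Poly_Mapping.lookup ?S (Node (Node Leaf Leaf corolla Leaf) Leaf Leaf Leaf) = x 3 * a + x 8 * c"
    "Poly_Mapping.lookup ?S (Node (Node Leaf Leaf Leaf corolla) Leaf Leaf Leaf) = x 4 * a + x 8 * d"
    "Poly_Mapping.lookup ?S (Node corolla corolla Leaf Leaf) = x 1 * b + x 5 * a"
    "Poly_Mapping.lookup ?S (Node corolla Leaf corolla Leaf) = x 1 * c + x 6 * a"
    "Poly_Mapping.lookup ?S (Node corolla Leaf Leaf corolla) = x 1 * d + x 7 * a"
    "Poly_Mapping.lookup ?S (Node Leaf (Node corolla Leaf Leaf Leaf) Leaf Leaf) = x 2 * b + x 9 * a"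
    "Poly_Mapping.lookup ?S (Node Leaf (Node Leaf corolla Leaf Leaf) Leaf Leaf) = x 3 * b + x 9 * b"
    "Poly_Mapping.lookup ?S (Node Leaf (Node Leaf Leaf corolla Leaf) Leaf Leaf) = x 4 * b + x 9 * c"
    "Poly_Mapping.lookup ?S (Node Leaf (Node Leaf Leaf Leaf corolla) Leaf Leaf) = x 5 * b + x 9 * d"
    "Poly_Mapping.lookup ?S (Node Leaf corolla corolla Leaf) = x 2 * c + x 6 * b"
    "Poly_Mapping.lookup ?S (Node Leaf corolla Leaf corolla) = x 2 * d + x 7 * b"
    "Poly_Mapping.lookup ?S (Node Leaf Leaf (Node corolla Leaf Leaf Leaf) Leaf) = x 3 * c + x 10 * a"
    "Poly_Mapping.lookup ?S (Node Leaf Leaf (Node Leaf corolla Leaf Leaf) Leaf) = x 4 * c + x 10 * b"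
    "Poly_Mapping.lookup ?S (Node Leaf Leaf (Node Leaf Leaf corolla Leaf) Leaf) = x 5 * c + x 10 * c"
    "Poly_Mapping.lookup ?S (Node Leaf Leaf (Node Leaf Leaf Leaf corolla) Leaf) = x 6 * c + x 10 * d"
    "Poly_Mapping.lookup ?S (Node Leaf Leaf corolla corolla) = x 3 * d + x 7 * c"
    "Poly_Mapping.lookup ?S (Node Leaf Leaf Leaf (Node corolla Leaf Leaf Leaf)) = x 4 * d + x 11 * a"
    "Poly_Mapping.lookup ?S (Node Leaf Leaf Leaf (Node Leaf corolla Leaf Leaf)) = x 5 * d + x 11 * b"
    "Poly_Mapping.lookup ?S (Node Leaf Leaf Leaf (Node Leaf Leaf corolla Leaf)) = x 6 * d + x 11 * c"
    "Poly_Mapping.lookup ?S (Node Leaf Leaf Leaf (Node Leaf Leaf Leaf corolla)) = x 7 * d + x 11 * d"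
    unfolding sum_consequences by (simp_all add: lookup_add lookup_scale lookup_tree_monomial)
  moreover assume "?S = 0"
  ultimately show "?R"
    by simp
qed (simp only: sum_consequences opd.scale_zero_left add_0_left)

text \<open>The index \<open>k\<close> is chosen such that a linear relation between the consequences is determined
  by its coefficient at \<open>k\<close>.\<close>

definition normalized :: "'a::field \<Rightarrow> 'a \<Rightarrow> 'a \<Rightarrow> 'a \<Rightarrow> nat \<Rightarrow> bool" where
  "normalized a b c d k \<longleftrightarrow> a = 1 \<and> k = 1 \<or> a = 0 \<and> b = 1 \<and> k = 3 \<or>
    a = 0 \<and> b = 0 \<and> c = 1 \<and> k = 5 \<or> a = 0 \<and> b = 0 \<and> c = 0 \<and> d = 1 \<and> k = 7"

lemma normalized_cases [consumes 1]:
  assumes "normalized a b c d k"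
  obtains "a = 1" "k = 1" | "a = 0" "b = 1" "k = 3" | "a = 0" "b = 0" "c = 1" "k = 5"
    | "a = 0" "b = 0" "c = 0" "d = 1" "k = 7"
  using assms unfolding normalized_def by blast

text \<open>The special relations in coordinates. The first nonzero entry is always 1, so they can
  be compared directly with normalized generators.\<close>

definition special_coeffs :: "('a::field \<times> 'a \<times> 'a \<times> 'a) set" where
  "special_coeffs = {(1, 0, 0, 0), (1, 0, 0, - 1), (1, - 1, 1, - 1)} \<union>
    {(1, \<alpha>, \<alpha>\<^sup>2, - 1) | \<alpha>. \<alpha>\<^sup>2 - \<alpha> + 1 = 0} \<union> {(0, 1, 0, 0), (0, 0, 1, 0), (0, 0, 0, 1)}"

text \<open>The equations propagate zero from \<open>x k\<close>. For \<open>a = 1\<close> the first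
  seven express \<open>x 2\<close> to \<open>x 8\<close> through \<open>x 1\<close>, and then
  \<open>x 9\<close>, \<open>x 10\<close>, \<open>x 11\<close> follow from \<open>x 2\<close>,
  \<open>x 3\<close>, \<open>x 4\<close>. In the other cases the unit coefficient plays the role of
  \<open>a\<close>. This yields rank at least 10.\<close>

lemma relation_unique:
  assumes "normalized a b c d k"
    and "(\<Sum>i\<in>{1..11}. scale (x i) (consequence (quad_comb a b c d) i)) = 0" and "x k = 0"
  shows "\<forall>i\<in>{1..11}. x i = 0"
proof -
  note E = assms(2)[unfolded relation_iff]
  from assms(1) have "x 1 = 0 \<and> x 2 = 0 \<and> x 3 = 0 \<and> x 4 = 0 \<and> x 5 = 0 \<and> x 6 = 0 \<and> x 7 = 0 \<and>
      x 8 = 0 \<and> x 9 = 0 \<and> x 10 = 0 \<and> x 11 = 0"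
  proof (cases rule: normalized_cases)
    case 1
    then have 1: "x 1 = 0" "x 8 = 0"
      using assms(3) E by simp_all
    then have "x 2 = 0" "x 3 = 0" "x 4 = 0" "x 5 = 0" "x 6 = 0" "x 7 = 0"
      using E \<open>a = 1\<close> by simp_all
    with 1 show ?thesis
      using E \<open>a = 1\<close> by simp
  next
    case 2
    then have x: "x 3 = 0" "x 1 = 0" "x 8 = 0" "x 2 = 0" "x 9 = 0"
      using assms(3) E by simp_all
    then have "x 4 = 0" "x 5 = 0" "x 6 = 0" "x 7 = 0"
      using E 2 by simp_all
    with x show ?thesis
      using E 2 by simp
  next
    case 3
    then have x: "x 5 = 0" "x 1 = 0" "x 8 = 0" "x 9 = 0" "x 2 = 0" "x 3 = 0" "x 4 = 0" "x 10 = 0"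
      using assms(3) E by simp_all
    then have "x 6 = 0" "x 7 = 0"
      using E 3 by simp_all
    with x show ?thesis
      using E 3 by simp
  next
    case 4
    then show ?thesis
      using assms(3) E by simp
  qed
  then show ?thesis
    unfolding atLeastAtMost_1_11 by blast
qed

lemma relation_imp_special:
  assumes "normalized a b c d k"
    and "(\<Sum>i\<in>{1..11}. scale (x i) (consequence (quad_comb a b c d) i)) = 0" and "x k \<noteq> 0"
  shows "(a, b, c, d) \<in> special_coeffs"
proof -
  note E = assms(2)[unfolded relation_iff]
  from assms(1) show ?thesis
  proof (cases rule: normalized_cases)
    case 1
    note E1 = E[unfolded 1 mult_1_right]
    define r where "r = x 1"
    have r: "r \<noteq> 0"
      using assms(3) 1 by (simp add: r_def)
    have x8: "x 8 = - r"
      unfolding r_def eq_neg_iff_add_eq_0 add.commute[of "x 8"] using E1 by blast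
    have l: "x 2 + x 8 * b = 0" "x 3 + x 8 * c = 0" "x 4 + x 8 * d = 0"
        "r * b + x 5 = 0" "r * c + x 6 = 0" "r * d + x 7 = 0"
      unfolding r_def using E1 by blast+
    have x: "x 2 = r * b" "x 3 = r * c" "x 4 = r * d" "x 5 = - (r * b)" "x 6 = - (r * c)" "x 7 = - (r * d)"
      using l x8 by algebra+
    have m: "x 2 * b + x 9 = 0" "x 3 * c + x 10 = 0" "x 4 * d + x 11 = 0"
      using E1 by blast+
    have y: "x 9 = - (r * b * b)" "x 10 = - (r * c * c)" "x 11 = - (r * d * d)"
      using m x(1-3) by algebra+
    \<comment> \<open>All unknowns are now multiples of \<open>r\<close>. Substituting them into
      these seven equations gives the constraints on \<open>b\<close>, \<open>c\<close> and
      \<open>d\<close>.\<close>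
    have q: "x 3 * b + x 9 * b = 0" "x 4 * b + x 9 * c = 0" "x 5 * b + x 9 * d = 0"
        "x 4 * c + x 10 * b = 0" "x 5 * c + x 10 * c = 0" "x 6 * c + x 10 * d = 0"
        "x 7 * d + x 11 * d = 0"
      using E1 by blast+
    have "r * (b * (c - b * b)) = 0"
      using q(1) x(2) y(1) by algebra
    moreover have "r * (b * (d - b * c)) = 0"
      using q(2) x(3) y(1) by algebra
    moreover have "r * (b * b * (d + 1)) = 0"
      using q(3) x(4) y(1) by algebra
    moreover have "r * (c * (d - c * b)) = 0"
      using q(4) x(3) y(2) by algebra
    moreover have "r * (c * (b + c * c)) = 0"
      using q(5) x(4) y(2) by algebra
    moreover have "r * (c * c * (d + 1)) = 0"
      using q(6) x(5) y(2) by algebra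
    moreover have "r * (d * d * (d + 1)) = 0"
      using q(7) x(6) y(3) by algebra
    ultimately have e: "b = 0 \<or> c = b * b" "b = 0 \<or> d = b * c" "b = 0 \<or> d = - 1"
        "c = 0 \<or> b + c * c = 0" "d = 0 \<or> d = - 1" "c = 0 \<or> d = c * b"
      using r by (simp_all only: mult_eq_0_iff right_minus_eq eq_neg_iff_add_eq_0) blast+
    show ?thesis
    proof (cases "b = 0")
      case True
      with e(4,6) have "c = 0"
        by auto
      with e(5) 1 True show ?thesis
        by (auto simp: special_coeffs_def)
    next
      case False
      with e(1-3) have bcd: "c = b\<^sup>2" "d = - 1" "d = b * c"
        unfolding power2_eq_square by blast+
      \<comment> \<open>Combining the three equations gives \<open>b^3 = -1\<close>, and this
        product is the factorization of \<open>b^3 + 1\<close>. The linear factor yields the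
        alternating relation, the quadratic one the two relations with \<alpha>.\<close>
      then have "(b + 1) * (b\<^sup>2 - b + 1) = 0"
        by algebra
      then have "b = - 1 \<or> b\<^sup>2 - b + 1 = 0"
        by (simp only: mult_eq_0_iff eq_neg_iff_add_eq_0)
      then show ?thesis
        unfolding special_coeffs_def 1 bcd(1,2) by auto
    qed
  next
    case 2
    \<comment> \<open>With \<open>a = 0\<close> and \<open>b = 1\<close>, nonzero \<open>x 3\<close>
      forces \<open>c = 0\<close>; \<open>x 2 = 0\<close> gives \<open>x 7 = 0\<close>, which
      reduces the equation \<open>x 3 * d + x 7 * c = 0\<close> to one forcing
      \<open>d = 0\<close>.\<close>
    with E have "x 3 * c = 0" "x 2 = 0"
      by simp_all
    then have "x 7 = 0"
      using E 2 by simp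
    then have "x 3 * d = 0"
      using E 2 by simp
    with \<open>x 3 * c = 0\<close> 2 assms(3) show ?thesis
      by (auto simp: special_coeffs_def)
  next
    case 3
    with E have "x 5 * d = 0"
      by simp
    with 3 assms(3) show ?thesis
      by (auto simp: special_coeffs_def)
  next
    case 4
    then show ?thesis
      by (auto simp: special_coeffs_def)
  qed
qed

lemma special_imp_relation:
  assumes "normalized a b c d k" "(a, b, c, d) \<in> special_coeffs"
  obtains x where "(\<Sum>i\<in>{1..11}. scale (x i) (consequence (quad_comb a b c d) i)) = 0" "x k \<noteq> 0"
proof -
  have cube: "b * b * b = - 1" if "b\<^sup>2 - b + 1 = 0"
    using that by algebra
  have "a = 1 \<and> (b = 0 \<and> c = 0 \<and> (d = 0 \<or> d = - 1) \<or> b = - 1 \<and> c = 1 \<and> d = - 1 \<or>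
      c = b\<^sup>2 \<and> d = - 1 \<and> b\<^sup>2 - b + 1 = 0) \<or>
    a = 0 \<and> (b = 1 \<and> c = 0 \<and> d = 0 \<or> b = 0 \<and> c = 1 \<and> d = 0 \<or> b = 0 \<and> c = 0 \<and> d = 1)"
    using assms(2) unfolding special_coeffs_def by blast
  \<comment> \<open>The alternating relation and the relations with \<alpha> are treated together:
    both satisfy \<open>c = b * b\<close>, \<open>d = - 1\<close> and
    \<open>b * b * b = - 1\<close>.\<close>
  then consider "a = 1" "b = 0 \<and> c = 0 \<and> (d = 0 \<or> d = - 1) \<or>
      c = b * b \<and> d = - 1 \<and> b * b * b = - 1"
    | "a = 0" "b = 1" "c = 0" "d = 0" | "a = 0" "b = 0" "c = 1" "d = 0"
    | "a = 0" "b = 0" "c = 0" "d = 1"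
    using cube unfolding power2_eq_square by fastforce
  then show ?thesis
  proof cases
    case 1
    \<comment> \<open>This is the solution found by elimination, scaled to \<open>x 1 = 1\<close>.
      The leading 0 is a dummy that makes list positions agree with indices starting at 1.\<close>
    define x where "x = (!) [0, 1, b, c, d, - b, - c, - d, - 1, - (b * b), - (c * c), - (d * d)]"
    have x: "x 1 = 1" "x 2 = b" "x 3 = c" "x 4 = d" "x 5 = - b" "x 6 = - c" "x 7 = - d" "x 8 = - 1"
        "x 9 = - (b * b)" "x 10 = - (c * c)" "x 11 = - (d * d)"
      by (simp_all add: x_def)
    show ?thesis
    proof (rule that)
      show "x k \<noteq> 0"
        using x 1(1) assms(1) by (simp add: normalized_def)
      show "(\<Sum>i\<in>{1..11}. scale (x i) (consequence (quad_comb a b c d) i)) = 0"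
        using 1(2)
      proof (elim disjE conjE)
        assume bcd: "c = b * b" "d = - 1" "b * b * b = - 1"
        have "b * (b * b) = - 1" "b * (b * (b * z)) = - z" for z
          using bcd(3) by (simp_all flip: mult.assoc)
        then show ?thesis
          unfolding relation_iff x 1(1) bcd(1,2) by (simp add: mult.assoc)
      next
        assume bc: "b = 0" "c = 0" and "d = 0"
        then show ?thesis
          unfolding relation_iff x 1(1) bc by simp
      next
        assume bc: "b = 0" "c = 0" and d: "d = - 1"
        show ?thesis
          unfolding relation_iff x 1(1) bc d by simp
      qed
    qed
  next
    case 2
    \<comment> \<open>For a single monomial the relation is operad associativity: grafting the
      generator into the second leaf of the inner node of \<open>quad 2\<close> equals grafting
      \<open>quad 2\<close> into the second leaf of the generator, so consequences 3 and 9 coincide.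
      The pairs 5, 10 and 7, 11 below arise likewise from \<open>quad 3\<close> and
      \<open>quad 4\<close>.\<close>
    show ?thesis
      by (rule that[of "\<lambda>i. if i = 3 then 1 else if i = 9 then - 1 else 0"], unfold relation_iff)
        (use 2 assms(1) in \<open>simp_all add: normalized_def\<close>)
  next
    case 3
    show ?thesis
      by (rule that[of "\<lambda>i. if i = 5 then 1 else if i = 10 then - 1 else 0"], unfold relation_iff)
        (use 3 assms(1) in \<open>simp_all add: normalized_def\<close>)
  next
    case 4
    show ?thesis
      by (rule that[of "\<lambda>i. if i = 7 then 1 else if i = 11 then - 1 else 0"], unfold relation_iff)
        (use 4 assms(1) in \<open>simp_all add: normalized_def\<close>)
  qed
qed

section \<open>The rank for each normalized quadratic relation\<close>

lemma cubic_rank_quad_comb: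
  assumes "normalized a b c d k"
  shows "cubic_rank (opd.span {quad_comb a b c d}) =
    (if (a, b, c, d) \<in> special_coeffs then 10 else 11)"
proof -
  let ?v = "consequence (quad_comb a b c d)"
  have rank: "cubic_rank (opd.span {quad_comb a b c d}) = opd.dim (opd.span (?v ` {1..11}))"
    by (simp add: cubic_rank_def ideal_gen_arity_10[OF quad_comb_arity])
  show ?thesis
  proof (cases "(a, b, c, d) \<in> special_coeffs")
    case True
    have k: "k \<in> {1..11}"
      using assms by (auto simp: normalized_def)
    obtain x where "(\<Sum>i\<in>{1..11}. scale (x i) (?v i)) = 0" "x k \<noteq> 0"
      using special_imp_relation[OF assms True] .
    then have "opd.span (?v ` {1..11}) = opd.span (?v ` ({1..11} - {k}))"
      using k by (intro opd.span_family_remove) auto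
    moreover have "opd.dim (opd.span (?v ` ({1..11} - {k}))) = card ({1..11} - {k})"
    proof (rule opd.dim_span_family)
      fix x assume x: "(\<Sum>i\<in>{1..11} - {k}. scale (x i) (?v i)) = 0"
      \<comment> \<open>A relation among the ten remaining consequences, extended by 0 at
        \<open>k\<close>, is a relation among all eleven that vanishes at \<open>k\<close>, hence
        trivial.\<close>
      have "(\<Sum>i\<in>{1..11}. scale ((x(k := 0)) i) (?v i)) = (\<Sum>i\<in>{1..11} - {k}. scale (x i) (?v i))"
        using k by (intro sum.mono_neutral_cong_right) auto
      with x relation_unique[OF assms, of "x(k := 0)"] show "\<forall>i\<in>{1..11} - {k}. x i = 0"
        by (auto split: if_splits)
    qed simp
    ultimately show ?thesis
      using True k by (simp add: rank card_Diff_singleton)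
  next
    case False
    have "opd.dim (opd.span (?v ` {1..11})) = card {1..11::nat}"
      using relation_unique[OF assms] relation_imp_special[OF assms] False
      by (intro opd.dim_span_family) blast+
    with False show ?thesis
      by (simp add: rank)
  qed
qed

lemma quad_comb_neq_0: "normalized a b c d k \<Longrightarrow> quad_comb a b c d \<noteq> 0"
  by (auto simp: quad_comb_eq_0 normalized_def)

lemma dim_span_singleton: "(x :: qtree \<Rightarrow>\<^sub>0 'a::field) \<noteq> 0 \<Longrightarrow> opd.dim (opd.span {x}) = 1"
  using opd.dim_span_family[of "{0::nat}" "\<lambda>_. x"] by simp

lemma quadratic_relation_line_quad_comb:
  assumes "normalized a b c d k"
  shows "quadratic_relation_line (opd.span {quad_comb a b c d})"
  unfolding quadratic_relation_line_def
  using opd.span_minimal[OF _ subspace_arity_space, of "{quad_comb a b c d}" 7] quad_comb_arity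
    dim_span_singleton[OF quad_comb_neq_0[OF assms]] by auto

lemma quadratic_relation_line_normalized:
  assumes "quadratic_relation_line R"
  obtains a b c d k where "normalized a b c d k" "R = opd.span {quad_comb a b c d}"
proof -
  have R: "opd.subspace R" "R \<subseteq> arity_space 7" "opd.dim R = 1"
    using assms by (auto simp: quadratic_relation_line_def)
  obtain B where B: "B \<subseteq> R" "opd.independent B" "R \<subseteq> opd.span B" "card B = opd.dim R"
    by (rule opd.basis_exists)
  then obtain y where y: "B = {y}"
    using R(3) card_1_singletonE by metis
  have Ry: "R = opd.span {y}"
    using B R(1) y opd.span_minimal by blast
  have "y \<noteq> 0"
    using B(2) y opd.dependent_zero by blast
  obtain p q r s where "y = quad_comb p q r s"
    using arity_space_7 B(1) R(2) y by blast
  \<comment> \<open>The first nonzero coordinate of the spanning vector; dividing by it keeps the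
    line and makes the leading coefficient 1.\<close>
  moreover define e where
    "e = (if p \<noteq> 0 then p else if q \<noteq> 0 then q else if r \<noteq> 0 then r else s)"
  ultimately have e: "e \<noteq> 0" and z: "scale (1 / e) y = quad_comb (p / e) (q / e) (r / e) (s / e)"
    using \<open>y \<noteq> 0\<close> by (auto simp: quad_comb_eq_0 scale_quad_comb)
  have "normalized (p / e) (q / e) (r / e) (s / e)
      (if p \<noteq> 0 then 1 else if q \<noteq> 0 then 3 else if r \<noteq> 0 then 5 else 7)"
    using e by (auto simp: normalized_def e_def)
  moreover have "R = opd.span {scale (1 / e) y}"
    using e opd.span_image_scale[of "{y}" "\<lambda>_. 1 / e"] by (simp add: Ry)
  ultimately show ?thesis
    using that z by metis
qed

section \<open>Special relations and nilpotency\<close>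

lemma special_relations_eq:
  "special_relations = (\<lambda>(a, b, c, d). quad_comb a b c d) ` special_coeffs"
proof -
  have "quad_comb 1 \<alpha> (\<alpha>\<^sup>2) (- 1) = quad 1 + scale \<alpha> (quad 2) + scale (\<alpha>\<^sup>2) (quad 3) - quad 4" for \<alpha> :: 'a
    by (simp add: quad_comb_def)
  then have "(\<lambda>(a, b, c, d). quad_comb a b c d) ` {(1, \<alpha>, \<alpha>\<^sup>2, - 1) | \<alpha> :: 'a. \<alpha>\<^sup>2 - \<alpha> + 1 = 0} =
      {quad 1 + scale \<alpha> (quad 2) + scale (\<alpha>\<^sup>2) (quad 3) - quad 4 | \<alpha>. \<alpha>\<^sup>2 - \<alpha> + 1 = 0}"
    by (simp only: setcompr_eq_image image_image prod.case)
  then show ?thesis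
    unfolding special_relations_def special_coeffs_def image_Un
    by (simp only:) (simp add: quad_comb_def)
qed

lemma quad_comb_special: "quad_comb a b c d \<in> special_relations \<longleftrightarrow> (a, b, c, d) \<in> special_coeffs"
  by (force simp: special_relations_eq quad_comb_inject)

lemma special_coeffs_normalized:
  assumes "(a, b, c, d) \<in> special_coeffs"
  obtains k where "normalized a b c d k"
  using assms unfolding special_coeffs_def normalized_def by auto

text \<open>Algebraic closedness supplies a root \<alpha>. Characteristic 0 makes 3 nonzero, which
  separates the two roots (the discriminant is -3) and keeps them away from -1, where the polynomial
  has value 3.\<close>

lemma card_special_relations:
  "card (special_relations :: (qtree \<Rightarrow>\<^sub>0 'a::{alg_closed_field, field_char_0}) set) = 8"
proof -
  have "\<exists>\<alpha>::'a. poly [:1, - 1, 1:] \<alpha> = 0"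
    by (rule alg_closed_imp_poly_has_root) simp
  then obtain \<alpha> :: 'a where "1 + \<alpha> * (\<alpha> - 1) = 0"
    by auto
  then have \<alpha>: "\<alpha>\<^sup>2 - \<alpha> + 1 = 0"
    by algebra
  \<comment> \<open>The two roots sum to 1.\<close>
  define \<beta> where "\<beta> = 1 - \<alpha>"
  have roots: "\<gamma>\<^sup>2 - \<gamma> + 1 = 0 \<longleftrightarrow> \<gamma> = \<alpha> \<or> \<gamma> = \<beta>" for \<gamma>
  proof -
    have "\<gamma>\<^sup>2 - \<gamma> + 1 = (\<gamma> - \<alpha>) * (\<gamma> - \<beta>)"
      using \<alpha> \<beta>_def by algebra
    then show ?thesis
      by (simp only: mult_eq_0_iff right_minus_eq)
  qed
  have three: "(3::'a) \<noteq> 0" by simp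
  have "\<gamma> \<noteq> 0" "\<gamma> \<noteq> - 1" if "\<gamma>\<^sup>2 - \<gamma> + 1 = 0" for \<gamma> :: 'a
    using that three by auto
  then have ne: "\<alpha> \<noteq> 0" "\<alpha> \<noteq> - 1" "\<beta> \<noteq> 0" "\<beta> \<noteq> - 1"
    using roots by blast+
  have "3 = (0::'a)" if "\<alpha> = \<beta>"
    using that \<alpha> \<beta>_def by algebra
  then have "\<alpha> \<noteq> \<beta>"
    using three by blast
  have "special_coeffs = {(1, 0, 0, 0), (1, 0, 0, - 1), (1, - 1, 1, - 1), (1, \<alpha>, \<alpha>\<^sup>2, - 1),
      (1, \<beta>, \<beta>\<^sup>2, - 1), (0, 1, 0, 0), (0, 0, 1, 0), (0, 0, 0, 1)}"
    unfolding special_coeffs_def roots by blast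
  moreover have "card \<dots> = 8"
    using ne ne[symmetric] \<open>\<alpha> \<noteq> \<beta>\<close> by simp
  ultimately have "card (special_coeffs :: ('a \<times> 'a \<times> 'a \<times> 'a) set) = 8"
    by simp
  moreover have inj: "inj_on (\<lambda>(a, b, c, d). quad_comb a b c d :: qtree \<Rightarrow>\<^sub>0 'a) special_coeffs"
    by (auto simp: inj_on_def quad_comb_inject)
  ultimately show ?thesis
    unfolding special_relations_eq card_image[OF inj] by blast
qed

section \<open>Failure of nilpotency of index 3\<close>

lemma independent_tree_monomials:
  assumes "finite A"
  shows "opd.independent (tree_monomial ` A :: (qtree \<Rightarrow>\<^sub>0 'a::field) set)"
    and "card (tree_monomial ` A :: (qtree \<Rightarrow>\<^sub>0 'a) set) = card A"
proof -
  have inj: "inj_on (tree_monomial :: qtree \<Rightarrow> qtree \<Rightarrow>\<^sub>0 'a) A"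
    by (rule inj_onI) (metis lookup_tree_monomial zero_neq_one)
  show "card (tree_monomial ` A :: (qtree \<Rightarrow>\<^sub>0 'a) set) = card A"
    by (rule card_image[OF inj])
  show "opd.independent (tree_monomial ` A :: (qtree \<Rightarrow>\<^sub>0 'a) set)"
    unfolding opd.dependent_finite[OF finite_imageI[OF assms]]
  proof safe
    fix u and t
    assume t: "t \<in> A" "u (tree_monomial t) \<noteq> (0::'a)"
      and "(\<Sum>w\<in>tree_monomial ` A. scale (u w) w) = 0"
    then have "Poly_Mapping.lookup (\<Sum>s\<in>A. scale (u (tree_monomial s)) (tree_monomial s)) t = 0"
      by (simp add: sum.reindex[OF inj])
    then show False
      using t assms
      by (simp add: lookup_sum lookup_scale lookup_tree_monomial if_distrib sum.delta cong: if_cong)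
  qed
qed

lemma tree_monomial_in_ideal:
  assumes "0 \<in> J" "quotient_class J (tree_monomial t) = quotient_class J 0"
  shows "tree_monomial t \<in> J"
proof -
  have "tree_monomial t \<in> quotient_class J (tree_monomial t)"
    using assms(1) by (simp add: quotient_class_def)
  then show ?thesis
    unfolding assms(2) by (simp add: quotient_class_def)
qed

lemma not_nilpotent:
  assumes \<rho>: "\<rho> \<in> arity_space 7"
  shows "\<not> quotient_nilpotent_of_index (ideal_gen (opd.span {\<rho>})) 3"
proof
  assume nil: "quotient_nilpotent_of_index (ideal_gen (opd.span {\<rho>})) 3"
  \<comment> \<open>Twelve of the 22 cubic monomials already suffice: nilpotency would put these
    independent vectors into the span of eleven consequences.\<close>
  define A where "A = {
    Node (Node corolla Leaf Leaf Leaf) Leaf Leaf Leaf,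
    Node (Node Leaf corolla Leaf Leaf) Leaf Leaf Leaf,
    Node (Node Leaf Leaf corolla Leaf) Leaf Leaf Leaf,
    Node (Node Leaf Leaf Leaf corolla) Leaf Leaf Leaf,
    Node corolla corolla Leaf Leaf,
    Node corolla Leaf corolla Leaf,
    Node corolla Leaf Leaf corolla,
    Node Leaf (Node corolla Leaf Leaf Leaf) Leaf Leaf,
    Node Leaf (Node Leaf corolla Leaf Leaf) Leaf Leaf,
    Node Leaf (Node Leaf Leaf corolla Leaf) Leaf Leaf,
    Node Leaf (Node Leaf Leaf Leaf corolla) Leaf Leaf,
    Node Leaf corolla corolla Leaf}"
  have fin: "finite A" and A: "card A = 12"
    by (simp_all add: A_def)
  have "tree_monomial t \<in> opd.span (consequence \<rho> ` {1..11})" if "t \<in> A" for t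
  proof -
    have w: "weight t = 3"
      using that by (auto simp: A_def)
    then have "tree_monomial t \<in> arity_space 10"
      by (simp add: arity_space_def tree_monomial_def leaves_eq_weight)
    moreover have "tree_monomial t \<in> ideal_gen (opd.span {\<rho>})"
      using nil w opd.subspace_0[OF subspace_ideal_gen]
      by (intro tree_monomial_in_ideal) (auto simp: quotient_nilpotent_of_index_def)
    ultimately show ?thesis
      using ideal_gen_arity_10[OF \<rho>] by blast
  qed
  then have "card (tree_monomial ` A :: (qtree \<Rightarrow>\<^sub>0 'a) set) \<le> card (consequence \<rho> ` {1..11})"
    using opd.independent_span_bound[OF _ independent_tree_monomials(1)[OF fin]] by blast
  also have "\<dots> \<le> card {1..11::nat}"
    by (rule card_image_le) simp
  finally show False
    by (simp add: independent_tree_monomials(2)[OF fin] A)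
qed

theorem theorem3p7:
  shows "(\<forall>R :: (qtree \<Rightarrow>\<^sub>0 'a::{alg_closed_field, field_char_0}) set.
            quadratic_relation_line R \<longrightarrow>
              cubic_rank R \<in> {10, 11} \<and> \<not> quotient_nilpotent_of_index (ideal_gen R) 3) \<and>
         card (special_relations :: (qtree \<Rightarrow>\<^sub>0 'a) set) = 8 \<and>
         (\<forall>\<rho> \<in> (special_relations :: (qtree \<Rightarrow>\<^sub>0 'a) set).
            quadratic_relation_line (opd.span {\<rho>}) \<and> cubic_rank (opd.span {\<rho>}) = 10) \<and>
         (\<forall>R :: (qtree \<Rightarrow>\<^sub>0 'a) set.
            quadratic_relation_line R \<and> (\<forall>\<rho>\<in>special_relations. R \<noteq> opd.span {\<rho>}) \<longrightarrow>
              cubic_rank R = 11)"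
proof (intro conjI allI impI ballI card_special_relations)
  fix R :: "(qtree \<Rightarrow>\<^sub>0 'a) set"
  assume "quadratic_relation_line R"
  then obtain a b c d k where R: "normalized a b c d k" "R = opd.span {quad_comb a b c d}"
    by (rule quadratic_relation_line_normalized)
  then show "cubic_rank R \<in> {10, 11}"
    by (simp add: cubic_rank_quad_comb)
  show "\<not> quotient_nilpotent_of_index (ideal_gen R) 3"
    unfolding R(2) by (rule not_nilpotent[OF quad_comb_arity])
next
  fix \<rho> :: "qtree \<Rightarrow>\<^sub>0 'a"
  assume "\<rho> \<in> special_relations"
  then obtain a b c d where \<rho>: "\<rho> = quad_comb a b c d" "(a, b, c, d) \<in> special_coeffs"
    by (auto simp: special_relations_eq)
  then obtain k where k: "normalized a b c d k"
    using special_coeffs_normalized by blast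
  show "quadratic_relation_line (opd.span {\<rho>})"
    unfolding \<rho>(1) by (rule quadratic_relation_line_quad_comb[OF k])
  show "cubic_rank (opd.span {\<rho>}) = 10"
    using \<rho> cubic_rank_quad_comb[OF k] by simp
next
  fix R :: "(qtree \<Rightarrow>\<^sub>0 'a) set"
  assume R: "quadratic_relation_line R \<and> (\<forall>\<rho>\<in>special_relations. R \<noteq> opd.span {\<rho>})"
  then obtain a b c d k where abcd: "normalized a b c d k" "R = opd.span {quad_comb a b c d}"
    using quadratic_relation_line_normalized by blast
  with R have "(a, b, c, d) \<notin> special_coeffs"
    by (auto simp flip: quad_comb_special)
  with abcd show "cubic_rank R = 11"
    by (simp add: cubic_rank_quad_comb)
qed

end
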